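(* Let $p\in\mathbb{C}$ with $\Re(p)>0$ or $p=0$, let $\mu>0$ and let $0<r<1$. Then $$S_{\mu,p}(r)=\frac{\sqrt{\pi}}{(2r)^{\mu-\frac12}\,\Gamma(\mu+1)}\int_0^\infty \frac{x^{\mu+\frac12}\,\mathrm{e}^{-\frac{p}{x}}}{\mathrm{e}^x-1}\,J_{\mu-\frac12}(rx)\,\mathrm{d}x .$$
   Context: $J_\nu$ denotes the Bessel function of the first kind, $J_\nu(x)=\sum_{n\ge 0}\frac{(-1)^n}{n!\,\Gamma(n+\nu+1)}\left(\frac{x}{2}\right)^{2n+\nu}$. The $p$-extended Riemann zeta function is $$\zeta_p(\alpha)=\frac{1}{\Gamma(\alpha)}\int_0^\infty \frac{x^{\alpha-1}\,\mathrm{e}^{-\frac{p}{x}}}{\mathrm{e}^x-1}\,\mathrm{d}x ,$$ for $\Re(p)>0$, or for $p=0$ and $\Re(\alpha)>1$ (for $p=0$ it is the Riemann zeta function). The $p$-extended Mathieu series is defined, for $\mu>0$ and real $|r|<1$, by $$S_{\mu,p}(r)=2\sum_{n\ge 0}(-1)^n\, r^{2n}\binom{\mu+n}{n}\,\zeta_p(2\mu+2n+1),$$ where $\binom{a}{b}=\frac{\Gamma(a+1)}{\Gamma(b+1)\Gamma(a-b+1)}$. *)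

theory Defs
  imports "HOL-Analysis.Analysis"
begin

text \<open>
  Real order and real argument; only the values at \<open>x > 0\<close> are meaningful, because of the
  conventions for \<open>powr\<close> at a base \<open>\<le> 0\<close>. Where \<open>n + \<nu> + 1\<close> is a pole, \<open>Gamma\<close> is 0 and the
  term vanishes, in accordance with \<open>1 / \<Gamma> = 0\<close> there.
\<close>

definition bessel_J :: "real \<Rightarrow> real \<Rightarrow> real" where
  "bessel_J \<nu> x =
     (\<Sum>n. (-1) ^ n / (fact n * Gamma (real n + \<nu> + 1)) * (x / 2) powr (2 * real n + \<nu>))"

text \<open>
  Meaningful for \<open>Re p > 0\<close>, and for \<open>p = 0\<close> with \<open>Re \<alpha> > 1\<close>; in these cases the integral
  converges absolutely.
\<close>

definition zeta_ext :: "complex \<Rightarrow> complex \<Rightarrow> complex" where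
  "zeta_ext p \<alpha> =
     1 / Gamma \<alpha> *
     (LBINT x:{0<..}. complex_of_real x powr (\<alpha> - 1) * exp (- p / complex_of_real x)
                        / complex_of_real (exp x - 1))"

definition Gamma_binomial :: "real \<Rightarrow> real \<Rightarrow> real" where
  "Gamma_binomial a b = Gamma (a + 1) / (Gamma (b + 1) * Gamma (a - b + 1))"

definition mathieu_ext :: "real \<Rightarrow> complex \<Rightarrow> real \<Rightarrow> complex" where
  "mathieu_ext \<mu> p r =
     2 * (\<Sum>n. complex_of_real ((-1) ^ n * r ^ (2 * n) * Gamma_binomial (\<mu> + real n) (real n))
                * zeta_ext p (complex_of_real (2 * \<mu> + 2 * real n + 1)))"

end

theory Submission
  imports Defs
begin

text \<open>
  Both sides are the same double object, a sum over \<open>n\<close> of integrals over \<open>x\<close>. Inserting the power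
  series of the Bessel function on the right gives, under the integral sign, multiples of the
  integrands \<open>x powr (2 * \<mu> + 2 * n) * exp (- p / x) / (exp x - 1)\<close> of \<open>zeta_ext p (2 * \<mu> + 2 * n + 1)\<close>. That their
  coefficients are those of the Mathieu series is Legendre's duplication formula: the factor
  \<open>1 / \<Gamma> (2\<mu> + 2n + 1)\<close> in front of the zeta integral splits into \<open>1 / \<Gamma> (\<mu> + n + 1/2)\<close>, which is
  the factor in the Bessel series, and \<open>1 / \<Gamma> (\<mu> + n + 1)\<close>, which cancels the numerator of the
  binomial coefficient (lemma \<open>mathieu_term_eq_bessel_term\<close>).

  What remains is the exchange of sum and integral, by absolute convergence. Since
  \<open>\<bar>exp (- p / x)\<bar> \<le> 1\<close> for \<open>Re p \<ge> 0\<close>, and \<open>1 / (exp x - 1) \<le> exp (- x) * (1 + 1 / x)\<close>, each zeta integral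
  is bounded in absolute value by \<open>\<Gamma> s + \<Gamma> (s - 1)\<close> with \<open>s = 2\<mu> + 2n + 1\<close>, that is, by a constant
  (independent of \<open>n\<close>) times the \<open>\<Gamma> s\<close> that it is divided by (lemma
  \<open>integral_norm_zeta_integrand_le\<close>). So the integrals of the absolute values are dominated by the
  coefficients \<open>r ^ (2 * n) * Gamma_binomial (\<mu> + n) n\<close>, the terms of the binomial series of
  \<open>(1 - r\<^sup>2)\<close> to the power \<open>- \<mu> - 1\<close>, and \<open>r < 1\<close> makes their sum finite. The
  ratio of \<open>\<Gamma> (s - 1)\<close> to \<open>\<Gamma> s\<close> is \<open>1 / (s - 1) \<le> 1 / (2 * \<mu>)\<close>; here \<open>\<mu> > 0\<close> enters.
\<close>

section \<open>The integrals defining the extended zeta function\<close>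

text \<open>
  The indicator function is part of the integrand so that sums, products and bounds can be
  handled on the whole real line, with ordinary integrals instead of set integrals.
\<close>

definition zeta_integrand :: "complex \<Rightarrow> real \<Rightarrow> real \<Rightarrow> complex" where
  "zeta_integrand p s x =
     indicator {0<..} x *\<^sub>R (complex_of_real (x powr (s - 1)) * exp (- p / complex_of_real x)
       / complex_of_real (exp x - 1))"

lemma zeta_integrand_measurable [measurable]: "zeta_integrand p s \<in> borel_measurable borel"
  unfolding zeta_integrand_def by measurable

lemma Gamma_times_zeta_ext:
  assumes "s > 0"
  shows "complex_of_real (Gamma s) * zeta_ext p (complex_of_real s) =
    (\<integral>x. zeta_integrand p s x \<partial>lborel)"
proof -
  have "(\<integral>x. zeta_integrand p s x \<partial>lborel) =
    (LBINT x:{0<..}. complex_of_real x powr (complex_of_real s - 1) * exp (- p / complex_of_real x)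
       / complex_of_real (exp x - 1))"
    unfolding set_lebesgue_integral_def
    by (rule Bochner_Integration.integral_cong)
       (auto simp: zeta_integrand_def indicator_def simp flip: powr_of_real)
  moreover have "Gamma s \<noteq> 0"
    using Gamma_real_pos[OF assms] by simp
  ultimately show ?thesis
    by (simp add: zeta_ext_def Gamma_complex_of_real)
qed

lemma has_bochner_integral_Gamma:
  fixes s :: real
  assumes "s > 0"
  shows "has_bochner_integral lborel (\<lambda>x. indicator {0<..} x * (x powr (s - 1) * exp (- x))) (Gamma s)"
proof (rule has_bochner_integral_nn_integral)
  have "(\<lambda>x. ennreal (indicator {0<..} x * (x powr (s - 1) * exp (- x)))) =
        (\<lambda>x. ennreal (indicator {0..} x * x powr (s - 1) / exp x))"
    by (auto simp: fun_eq_iff indicator_def exp_minus field_simps)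
  then show "(\<integral>\<^sup>+x. ennreal (indicator {0<..} x * (x powr (s - 1) * exp (- x))) \<partial>lborel) = ennreal (Gamma s)"
    using Gamma_conv_nn_integral_real[OF assms] by simp
qed (use assms Gamma_real_pos[OF assms] in \<open>auto simp: indicator_def\<close>)

text \<open>
  Decay like \<open>exp (- x)\<close> at infinity and a simple pole at \<open>0\<close> are kept in one bound that integrates
  to Gamma values when multiplied by a power of \<open>x\<close>. Cleared of denominators it is
  \<open>1 + x \<le> exp x\<close>.
\<close>

lemma inverse_expm1_le:
  fixes x :: real
  assumes "x > 0"
  shows "1 / (exp x - 1) \<le> exp (- x) * (1 + 1 / x)"
proof -
  have "1 + x \<le> exp x" by (rule exp_ge_add_one_self)
  then have "x * exp x \<le> (exp x - 1) * (x + 1)"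
    by (simp add: algebra_simps)
  moreover have "exp x - 1 > 0" using assms by simp
  ultimately show ?thesis
    using assms by (simp add: exp_minus field_simps)
qed

text \<open>
  This is \<open>x powr (s - 1) * exp (- x) * (1 + 1 / x)\<close>, written as the Gamma integrands of \<open>s\<close> and
  \<open>s - 1\<close>.
\<close>

definition zeta_majorant :: "real \<Rightarrow> real \<Rightarrow> real" where
  "zeta_majorant s x = indicator {0<..} x * (x powr (s - 1) * exp (- x))
     + indicator {0<..} x * (x powr (s - 1 - 1) * exp (- x))"

lemma has_bochner_integral_zeta_majorant:
  assumes "s > 1"
  shows "has_bochner_integral lborel (zeta_majorant s) (Gamma s + Gamma (s - 1))"
  unfolding zeta_majorant_def
  using assms by (intro has_bochner_integral_add has_bochner_integral_Gamma) auto

lemma norm_zeta_integrand_le: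
  assumes "Re p \<ge> 0"
  shows "norm (zeta_integrand p s x) \<le> zeta_majorant s x"
proof (cases "x > 0")
  case True
  have "norm (exp (- p / complex_of_real x)) \<le> 1"
    using assms True by simp
  then have "x powr (s - 1) * norm (exp (- p / complex_of_real x)) / (exp x - 1)
      \<le> x powr (s - 1) * 1 / (exp x - 1)"
    using True by (intro divide_right_mono mult_left_mono) auto
  moreover have "norm (zeta_integrand p s x) =
      x powr (s - 1) * norm (exp (- p / complex_of_real x)) / (exp x - 1)"
    using True
    by (simp add: zeta_integrand_def norm_mult norm_divide del: of_real_diff norm_exp_eq_Re)
  ultimately have "norm (zeta_integrand p s x) \<le> x powr (s - 1) * (1 / (exp x - 1))"
    by simp
  also have "\<dots> \<le> x powr (s - 1) * (exp (- x) * (1 + 1 / x))"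
    using inverse_expm1_le[OF True] by (intro mult_left_mono) auto
  also have "\<dots> = zeta_majorant s x"
    using True by (simp add: zeta_majorant_def powr_diff power2_eq_square field_simps)
  finally show ?thesis .
qed (simp add: zeta_integrand_def zeta_majorant_def)

lemma integrable_zeta_integrand:
  assumes "Re p \<ge> 0" "s > 1"
  shows "integrable lborel (zeta_integrand p s)"
proof (rule Bochner_Integration.integrable_bound)
  show "integrable lborel (zeta_majorant s)"
    using has_bochner_integral_zeta_majorant[OF assms(2)] by (rule integrable.intros)
  show "AE x in lborel. norm (zeta_integrand p s x) \<le> norm (zeta_majorant s x)"
    using norm_zeta_integrand_le[OF assms(1)] by (intro AE_I2) (simp add: order_trans[OF _ abs_ge_self])
qed simp

lemma Gamma_plus1_pos:
  fixes z :: real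
  assumes "z > 0"
  shows "Gamma (z + 1) = z * Gamma z"
proof (rule Gamma_plus1)
  show "z \<notin> \<int>\<^sub>\<le>\<^sub>0"
    using assms by (auto elim!: nonpos_Ints_cases)
qed

text \<open>
  The bound is a multiple of \<open>Gamma s\<close>, the normalising factor of the extended zeta function,
  and the multiple stays bounded as \<open>s\<close> grows; this is the uniformity in \<open>n\<close> that the exchange of
  sum and integral rests on.
\<close>

lemma integral_norm_zeta_integrand_le:
  assumes "Re p \<ge> 0" "s > 1"
  shows "(\<integral>x. norm (zeta_integrand p s x) \<partial>lborel) \<le> (1 + 1 / (s - 1)) * Gamma s"
proof -
  have "(\<integral>x. norm (zeta_integrand p s x) \<partial>lborel) \<le> (\<integral>x. zeta_majorant s x \<partial>lborel)"
    using has_bochner_integral_zeta_majorant[OF assms(2)]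
    by (intro integral_mono integrable_norm integrable_zeta_integrand assms norm_zeta_integrand_le)
       (rule integrable.intros)
  also have "\<dots> = Gamma s + Gamma (s - 1)"
    using has_bochner_integral_zeta_majorant[OF assms(2)] by (rule has_bochner_integral_integral_eq)
  also have "Gamma (s - 1) = Gamma s / (s - 1)"
    using Gamma_plus1_pos[of "s - 1"] assms(2) by simp
  then have "Gamma s + Gamma (s - 1) = (1 + 1 / (s - 1)) * Gamma s"
    by (simp add: distrib_right)
  finally show ?thesis .
qed

section \<open>Coefficients of the Mathieu and Bessel series\<close>

definition mathieu_coeff :: "real \<Rightarrow> real \<Rightarrow> nat \<Rightarrow> real" where
  "mathieu_coeff \<mu> r n = (-1) ^ n * r ^ (2 * n) * Gamma_binomial (\<mu> + real n) (real n)"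

lemma Gamma_binomial_eq_gchoose:
  assumes "\<mu> > 0"
  shows "Gamma_binomial (\<mu> + real n) (real n) = (-1) ^ n * ((- \<mu> - 1) gchoose n)"
proof -
  have "pochhammer (\<mu> + 1) n = Gamma (\<mu> + 1 + real n) / Gamma (\<mu> + 1)"
    using assms by (intro pochhammer_Gamma) (auto elim!: nonpos_Ints_cases)
  then show ?thesis
    by (simp add: Gamma_binomial_def gbinomial_pochhammer Gamma_fact add_ac field_simps
        flip: power_mult_distrib)
qed

text \<open>
  The Gamma quotients are positive, so the sign \<open>(-1) ^ n\<close> is the only one: the absolute values are
  the terms of the binomial series with exponent \<open>- \<mu> - 1\<close> at \<open>- r\<^sup>2\<close>, inside its disc of convergence.
\<close>

lemma summable_abs_mathieu_coeff:
  assumes "\<mu> > 0" "0 < r" "r < 1"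
  shows "summable (\<lambda>n. \<bar>mathieu_coeff \<mu> r n\<bar>)"
proof -
  have "\<bar>- (r\<^sup>2)\<bar> < 1"
    using assms by (simp add: power_less_one_iff abs_square_less_1)
  then have "summable (\<lambda>n. ((- \<mu> - 1) gchoose n) * (- (r\<^sup>2)) ^ n)"
    using gen_binomial_real by (blast intro: sums_summable)
  moreover have "((- \<mu> - 1) gchoose n) * (- (r\<^sup>2)) ^ n = \<bar>mathieu_coeff \<mu> r n\<bar>" for n
  proof -
    have "Gamma_binomial (\<mu> + real n) (real n) \<ge> 0"
      using assms by (auto simp: Gamma_binomial_def intro!: divide_nonneg_nonneg mult_nonneg_nonneg
          less_imp_le[OF Gamma_real_pos])
    then have "\<bar>mathieu_coeff \<mu> r n\<bar> = r ^ (2 * n) * Gamma_binomial (\<mu> + real n) (real n)"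
      using assms by (simp add: mathieu_coeff_def abs_mult)
    also have "\<dots> = ((- \<mu> - 1) gchoose n) * (- (r\<^sup>2)) ^ n"
      unfolding Gamma_binomial_eq_gchoose[OF assms(1)]
      by (subst power_minus) (simp add: power_mult)
    finally show ?thesis by simp
  qed
  ultimately show ?thesis by simp
qed

text \<open>The real case is read off from the complex one along \<open>complex_of_real\<close>.\<close>

lemma Gamma_legendre_duplication_real:
  fixes z :: real
  assumes "z > 0"
  shows "Gamma z * Gamma (z + 1 / 2) = 2 powr (1 - 2 * z) * sqrt pi * Gamma (2 * z)"
proof -
  have "complex_of_real z \<notin> \<int>\<^sub>\<le>\<^sub>0" "complex_of_real z + 1 / 2 \<notin> \<int>\<^sub>\<le>\<^sub>0"
    using assms by (auto elim!: nonpos_Ints_cases simp: complex_eq_iff)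
  from Gamma_legendre_duplication[OF this]
  have "Gamma (complex_of_real z) * Gamma (complex_of_real (z + 1 / 2)) =
    exp (complex_of_real ((1 - 2 * z) * ln 2)) * of_real (sqrt pi) * Gamma (complex_of_real (2 * z))"
    by simp
  then have "complex_of_real (Gamma z * Gamma (z + 1 / 2)) =
      complex_of_real (exp ((1 - 2 * z) * ln 2) * sqrt pi * Gamma (2 * z))"
    unfolding Gamma_complex_of_real exp_of_real by simp
  then show ?thesis
    unfolding of_real_eq_iff by (simp add: powr_def)
qed

definition bessel_term :: "real \<Rightarrow> nat \<Rightarrow> real \<Rightarrow> real" where
  "bessel_term \<nu> n x =
     (-1) ^ n / (fact n * Gamma (real n + \<nu> + 1)) * (x / 2) powr (2 * real n + \<nu>)"

text \<open>
  The termwise identity behind the theorem. The duplication formula at \<open>z = \<mu> + n + 1/2\<close> turns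
  \<open>\<Gamma> (2z)\<close> into \<open>\<Gamma> z * \<Gamma> (z + 1/2)\<close>, where the second factor is the numerator of the binomial
  coefficient; the leftover powers of \<open>2\<close> and \<open>r\<close> are divided between the constant in front of the
  integral and the argument \<open>r * x / 2\<close> of the Bessel series.
\<close>

lemma mathieu_term_eq_bessel_term:
  assumes "\<mu> > 0" "r > 0" "x > 0"
  shows "2 * (mathieu_coeff \<mu> r n / Gamma (2 * \<mu> + 2 * real n + 1)) * x powr (2 * \<mu> + 2 * real n) =
    sqrt pi / ((2 * r) powr (\<mu> - 1 / 2) * Gamma (\<mu> + 1)) *
      (x powr (\<mu> + 1 / 2) * bessel_term (\<mu> - 1 / 2) n (r * x))"
proof -
  define G where "G = Gamma (real n + \<mu> + 1 / 2)"
  define H where "H = Gamma (real n + \<mu> + 1)"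
  define D where "D = Gamma (2 * \<mu> + 2 * real n + 1)"
  define E where "E = Gamma (\<mu> + 1)"
  have pos: "G > 0" "H > 0" "D > 0" "E > 0"
    using assms by (auto simp: G_def H_def D_def E_def intro!: Gamma_real_pos)
  have dup: "G * H = 2 powr (- 2 * \<mu> - 2 * real n) * sqrt pi * D"
    using Gamma_legendre_duplication_real[of "real n + \<mu> + 1 / 2"] assms
    by (simp add: G_def H_def D_def add_ac algebra_simps)
  have coeff: "mathieu_coeff \<mu> r n = (-1) ^ n * r ^ (2 * n) * (H / (fact n * E))"
    by (simp add: mathieu_coeff_def Gamma_binomial_def H_def E_def Gamma_fact add_ac)
  have powers: "x powr (\<mu> + 1 / 2) * (r * x / 2) powr (2 * real n + (\<mu> - 1 / 2)) =
      (2 * r) powr (\<mu> - 1 / 2) * (2 * 2 powr (- 2 * \<mu> - 2 * real n) * r ^ (2 * n)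
        * x powr (2 * \<mu> + 2 * real n))"
  proof -
    have "r ^ (2 * n) = r powr (2 * real n)"
      using assms by (simp flip: powr_realpow)
    moreover have "2 * 2 powr (- 2 * \<mu> - 2 * real n) = 2 powr (1 - 2 * \<mu> - 2 * real n)"
      by (simp add: powr_diff powr_minus powr_add field_simps)
    ultimately show ?thesis
      using assms by (simp add: powr_def ln_mult ln_div algebra_simps flip: exp_add)
  qed
  have "D = G * H / (2 powr (- 2 * \<mu> - 2 * real n) * sqrt pi)"
    using dup by simp
  then have "2 * (mathieu_coeff \<mu> r n / D) * x powr (2 * \<mu> + 2 * real n) =
    sqrt pi / E * ((-1) ^ n / (fact n * G)) * (2 * 2 powr (- 2 * \<mu> - 2 * real n) * r ^ (2 * n)
        * x powr (2 * \<mu> + 2 * real n))"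
    using pos by (simp add: coeff mult_ac)
  also have "\<dots> = sqrt pi / ((2 * r) powr (\<mu> - 1 / 2) * E) * ((-1) ^ n / (fact n * G)) *
      (x powr (\<mu> + 1 / 2) * (r * x / 2) powr (2 * real n + (\<mu> - 1 / 2)))"
    unfolding powers using assms by simp
  finally show ?thesis
    by (simp add: bessel_term_def G_def D_def E_def add_ac)
qed

text \<open>
  Each step of the functional equation multiplies by a factor of at least \<open>1/2\<close>. This crude
  bound suffices because the factorial in the Bessel series already forces convergence.
\<close>

lemma Gamma_add_nat_ge:
  fixes a :: real
  assumes "a \<ge> 1 / 2"
  shows "Gamma (a + real n) \<ge> Gamma a / 2 ^ n"
proof (induction n)
  case (Suc n)
  have pos: "Gamma (a + real n) > 0"
    using assms by (intro Gamma_real_pos) auto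
  have "Gamma a / 2 ^ Suc n \<le> 1 / 2 * Gamma (a + real n)"
    using Suc by simp
  also have "\<dots> \<le> (a + real n) * Gamma (a + real n)"
    using assms pos by (intro mult_right_mono) auto
  also have "\<dots> = Gamma (a + real (Suc n))"
    using Gamma_plus1_pos[of "a + real n"] assms by (simp add: add_ac)
  finally show ?case .
qed simp

lemma summable_abs_bessel_term:
  assumes "\<nu> \<ge> - 1 / 2" "x > 0"
  shows "summable (\<lambda>n. \<bar>bessel_term \<nu> n x\<bar>)"
proof (rule summable_comparison_test')
  define C where "C = (x / 2) powr \<nu> / Gamma (\<nu> + 1)"
  show "summable (\<lambda>n. C * (inverse (fact n) * (2 * (x / 2)\<^sup>2) ^ n))"
    by (intro summable_mult summable_exp)
  fix n
  have G: "Gamma (\<nu> + 1) > 0" "Gamma (\<nu> + 1 + real n) > 0"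
    using assms by (auto intro!: Gamma_real_pos)
  have recip: "1 / Gamma (\<nu> + 1 + real n) \<le> 1 / (Gamma (\<nu> + 1) / 2 ^ n)"
    using assms G by (intro divide_left_mono Gamma_add_nat_ge) auto
  have power: "(x / 2) powr (2 * real n + \<nu>) = (x / 2) powr \<nu> * (x / 2) ^ (2 * n)"
    using assms powr_realpow[of "x / 2" "2 * n"] by (simp add: powr_add)
  have arg: "real n + \<nu> + 1 = \<nu> + 1 + real n"
    by simp
  have "\<bar>bessel_term \<nu> n x\<bar> =
    (x / 2) powr \<nu> * (x / 2) ^ (2 * n) / fact n * (1 / Gamma (\<nu> + 1 + real n))"
    unfolding bessel_term_def power arg using G assms by (simp add: abs_mult)
  also have "\<dots> \<le> (x / 2) powr \<nu> * (x / 2) ^ (2 * n) / fact n * (2 ^ n / Gamma (\<nu> + 1))"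
    using assms recip by (intro mult_left_mono) auto
  also have "\<dots> = C * (inverse (fact n) * (2 * (x / 2)\<^sup>2) ^ n)"
    unfolding C_def power_mult power_mult_distrib[of 2] by (simp add: field_simps)
  finally show "norm \<bar>bessel_term \<nu> n x\<bar> \<le> C * (inverse (fact n) * (2 * (x / 2)\<^sup>2) ^ n)"
    by simp
qed

section \<open>Termwise integration\<close>

theorem theorem1:
  fixes p :: complex and \<mu> r :: real
  assumes "Re p > 0 \<or> p = 0" and "\<mu> > 0" and "0 < r" and "r < 1"
  shows "mathieu_ext \<mu> p r =
    complex_of_real (sqrt pi / ((2 * r) powr (\<mu> - 1 / 2) * Gamma (\<mu> + 1))) *
    (LBINT x:{0<..}. complex_of_real (x powr (\<mu> + 1 / 2)) * exp (- p / complex_of_real x)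
                       / complex_of_real (exp x - 1) * complex_of_real (bessel_J (\<mu> - 1 / 2) (r * x)))"
proof -
  have p: "Re p \<ge> 0"
    using assms(1) by auto
  define s where "s n = 2 * \<mu> + 2 * real n + 1" for n
  have s: "s n > 1" for n
    using assms by (simp add: s_def)
  have Gamma_s: "Gamma (s n) > 0" for n
    using s[of n] by (intro Gamma_real_pos) simp
  define K where "K = sqrt pi / ((2 * r) powr (\<mu> - 1 / 2) * Gamma (\<mu> + 1))"
  define w where "w x = indicator {0<..} x *\<^sub>R (complex_of_real (x powr (\<mu> + 1 / 2))
    * exp (- p / complex_of_real x) / complex_of_real (exp x - 1))" for x
  define c where "c n = 2 * (mathieu_coeff \<mu> r n / Gamma (s n))" for n
  define F where "F n x = c n *\<^sub>R zeta_integrand p (s n) x" for n x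
  have F_eq: "F n x = K *\<^sub>R (bessel_term (\<mu> - 1 / 2) n (r * x) *\<^sub>R w x)" for n x
  proof (cases "x > 0")
    case True
    define e where "e = exp (- p / complex_of_real x) / complex_of_real (exp x - 1)"
    have "F n x = (c n * x powr (2 * \<mu> + 2 * real n)) *\<^sub>R e"
      using True by (simp add: F_def zeta_integrand_def s_def e_def scaleR_conv_of_real)
    also have "c n * x powr (2 * \<mu> + 2 * real n) =
        K * (x powr (\<mu> + 1 / 2) * bessel_term (\<mu> - 1 / 2) n (r * x))"
      using mathieu_term_eq_bessel_term[OF assms(2,3) True] by (simp add: c_def s_def K_def)
    finally show ?thesis
      using True by (simp add: w_def e_def scaleR_conv_of_real)
  qed (simp add: F_def zeta_integrand_def w_def)
  have int_F: "integrable lborel (F n)" for n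
    unfolding F_def by (intro integrable_scaleR_right integrable_zeta_integrand p s)
  have summable_F: "summable (\<lambda>n. norm (F n x))" for x
  proof (cases "x > 0")
    case True
    have "summable (\<lambda>n. \<bar>bessel_term (\<mu> - 1 / 2) n (r * x)\<bar> * (\<bar>K\<bar> * norm (w x)))"
      using assms True by (intro summable_mult2 summable_abs_bessel_term) auto
    moreover have "norm (F n x) = \<bar>bessel_term (\<mu> - 1 / 2) n (r * x)\<bar> * (\<bar>K\<bar> * norm (w x))" for n
      by (simp add: F_eq abs_mult)
    ultimately show ?thesis
      by simp
  qed (simp add: F_def zeta_integrand_def)
  \<comment> \<open>the bound on the zeta integrals is used at \<open>s n - 1 \<ge> 2 * \<mu>\<close>, which makes the constant independent of \<open>n\<close>\<close>
  have summable_int: "summable (\<lambda>n. \<integral>x. norm (F n x) \<partial>lborel)"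
  proof (rule summable_comparison_test')
    show "summable (\<lambda>n. 2 * (1 + 1 / (2 * \<mu>)) * \<bar>mathieu_coeff \<mu> r n\<bar>)"
      using assms by (intro summable_mult summable_abs_mathieu_coeff)
    fix n
    have "(\<integral>x. norm (F n x) \<partial>lborel) = \<bar>c n\<bar> * (\<integral>x. norm (zeta_integrand p (s n) x) \<partial>lborel)"
      by (simp add: F_def)
    also have "\<dots> \<le> \<bar>c n\<bar> * ((1 + 1 / (s n - 1)) * Gamma (s n))"
      by (intro mult_left_mono integral_norm_zeta_integrand_le p s) auto
    also have "\<dots> = 2 * (1 + 1 / (s n - 1)) * \<bar>mathieu_coeff \<mu> r n\<bar>"
      using Gamma_s[of n] by (simp add: c_def abs_mult)
    also have "\<dots> \<le> 2 * (1 + 1 / (2 * \<mu>)) * \<bar>mathieu_coeff \<mu> r n\<bar>"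
      using assms by (intro mult_right_mono mult_left_mono add_left_mono divide_left_mono)
        (auto simp: s_def intro!: mult_pos_pos add_pos_nonneg)
    finally show "norm (\<integral>x. norm (F n x) \<partial>lborel) \<le> 2 * (1 + 1 / (2 * \<mu>)) * \<bar>mathieu_coeff \<mu> r n\<bar>"
      by simp
  qed
  have int_F_eq: "(\<integral>x. F n x \<partial>lborel) =
      2 * (complex_of_real (mathieu_coeff \<mu> r n) * zeta_ext p (complex_of_real (s n)))" for n
  proof -
    have "(\<integral>x. F n x \<partial>lborel) = c n *\<^sub>R (complex_of_real (Gamma (s n)) * zeta_ext p (complex_of_real (s n)))"
      using s[of n] by (simp add: F_def Gamma_times_zeta_ext)
    then show ?thesis
      using Gamma_s[of n] by (simp add: c_def scaleR_conv_of_real)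
  qed
  have sums: "(\<lambda>n. \<integral>x. F n x \<partial>lborel) sums (\<integral>x. (\<Sum>n. F n x) \<partial>lborel)"
    using int_F summable_F summable_int by (intro sums_integral) auto
  have sum_F: "(\<Sum>n. F n x) = K *\<^sub>R (bessel_J (\<mu> - 1 / 2) (r * x) *\<^sub>R w x)" for x
  proof (cases "x > 0")
    case True
    have "summable (\<lambda>n. bessel_term (\<mu> - 1 / 2) n (r * x))"
      using assms True by (intro summable_rabs_cancel[OF summable_abs_bessel_term]) auto
    then have "(\<lambda>n. bessel_term (\<mu> - 1 / 2) n (r * x)) sums bessel_J (\<mu> - 1 / 2) (r * x)"
      unfolding bessel_J_def bessel_term_def by (rule summable_sums)
    then have "(\<lambda>n. F n x) sums (K *\<^sub>R (bessel_J (\<mu> - 1 / 2) (r * x) *\<^sub>R w x))"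
      unfolding F_eq by (intro sums_scaleR_right sums_scaleR_left)
    then show ?thesis
      by (simp add: sums_iff)
  qed (simp add: F_eq w_def)
  have "mathieu_ext \<mu> p r = (\<Sum>n. \<integral>x. F n x \<partial>lborel)"
  proof -
    have "summable (\<lambda>n. 2 * (complex_of_real (mathieu_coeff \<mu> r n) * zeta_ext p (complex_of_real (s n))))"
      using sums unfolding int_F_eq by (rule sums_summable)
    then have "summable (\<lambda>n. complex_of_real (mathieu_coeff \<mu> r n) * zeta_ext p (complex_of_real (s n)))"
      by (subst (asm) summable_cmult_iff) simp
    from suminf_mult[OF this, of 2] show ?thesis
      unfolding int_F_eq by (simp add: mathieu_ext_def mathieu_coeff_def s_def)
  qed
  also have "\<dots> = (\<integral>x. K *\<^sub>R (bessel_J (\<mu> - 1 / 2) (r * x) *\<^sub>R w x) \<partial>lborel)"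
    using sums by (simp add: sums_iff sum_F)
  also have "\<dots> = complex_of_real K * (\<integral>x. bessel_J (\<mu> - 1 / 2) (r * x) *\<^sub>R w x \<partial>lborel)"
    by (simp add: scaleR_conv_of_real)
  also have "(\<integral>x. bessel_J (\<mu> - 1 / 2) (r * x) *\<^sub>R w x \<partial>lborel) =
     (LBINT x:{0<..}. complex_of_real (x powr (\<mu> + 1 / 2)) * exp (- p / complex_of_real x)
                       / complex_of_real (exp x - 1) * complex_of_real (bessel_J (\<mu> - 1 / 2) (r * x)))"
    unfolding set_lebesgue_integral_def
    by (rule Bochner_Integration.integral_cong)
       (simp_all add: w_def scaleR_conv_of_real mult_ac)
  finally show ?thesis
    by (simp only: K_def)
qed

end
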